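(* Let $d\in\mathbb{N}$ and $1\le r<\infty$. Then for any integer $k\ge\lceil19^r\rceil^{2d-1}+1$ and any step preserving continuous map $F\colon S_{\ell_\infty^k}\to S_{\ell_r^k}$ such that $F(1,\dots,1)\ne F(-1,\dots,-1)$, we have $\omega_F(\tfrac1d)\ge\tfrac12$. In particular, there is no sequence $(F_k\colon S_{\ell_\infty^k}\to S_{\ell_r^k})_{k=1}^\infty$ of equi-uniformly continuous step preserving homeomorphisms.
   Context: $S_{\ell_p^k}$ is the unit sphere of $(\mathbb{R}^k,\|\cdot\|_p)$. $F=(F_i)$ is step preserving if $x_i=x_j$ implies $F_i(x)=F_j(x)$. $\omega_F(t)=\sup\{\|F(x)-F(y)\|_r:\|x-y\|_\infty\le t\}$. $(F_k)$ is equi-uniformly continuous if for every $\varepsilon>0$ there is $\delta>0$ with $\omega_{F_k}(\delta)<\varepsilon$ for all $k$. *)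

theory Defs
  imports "HOL-Analysis.Analysis"
begin

text \<open>Vectors of R^k are represented as functions nat => real supported on {..<k}.\<close>

definition vec_on :: "nat \<Rightarrow> (nat \<Rightarrow> real) \<Rightarrow> bool" where
  "vec_on k x \<longleftrightarrow> (\<forall>i\<ge>k. x i = 0)"

definition linf_norm :: "nat \<Rightarrow> (nat \<Rightarrow> real) \<Rightarrow> real" where
  "linf_norm k x = Max (insert 0 ((\<lambda>i. \<bar>x i\<bar>) ` {..<k}))"

definition lp_norm :: "nat \<Rightarrow> real \<Rightarrow> (nat \<Rightarrow> real) \<Rightarrow> real" where
  "lp_norm k p x = (\<Sum>i<k. \<bar>x i\<bar> powr p) powr (1 / p)"

definition sphere_inf :: "nat \<Rightarrow> (nat \<Rightarrow> real) set" where
  "sphere_inf k = {x. vec_on k x \<and> linf_norm k x = 1}"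

definition sphere_lp :: "nat \<Rightarrow> real \<Rightarrow> (nat \<Rightarrow> real) set" where
  "sphere_lp k p = {x. vec_on k x \<and> lp_norm k p x = 1}"

definition const_vec :: "nat \<Rightarrow> real \<Rightarrow> (nat \<Rightarrow> real)" where
  "const_vec k c = (\<lambda>i. if i < k then c else 0)"

definition step_preserving :: "nat \<Rightarrow> ((nat \<Rightarrow> real) \<Rightarrow> (nat \<Rightarrow> real)) \<Rightarrow> bool" where
  "step_preserving k F \<longleftrightarrow>
     (\<forall>x\<in>sphere_inf k. \<forall>i<k. \<forall>j<k. x i = x j \<longrightarrow> F x i = F x j)"

definition modulus :: "nat \<Rightarrow> real \<Rightarrow> ((nat \<Rightarrow> real) \<Rightarrow> (nat \<Rightarrow> real)) \<Rightarrow> real \<Rightarrow> real" where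
  "modulus k r F t = Sup {lp_norm k r (F x - F y) | x y.
      x \<in> sphere_inf k \<and> y \<in> sphere_inf k \<and> linf_norm k (x - y) \<le> t}"

definition cont_inf_lp :: "nat \<Rightarrow> real \<Rightarrow> ((nat \<Rightarrow> real) \<Rightarrow> (nat \<Rightarrow> real)) \<Rightarrow> bool" where
  "cont_inf_lp k r F \<longleftrightarrow> (\<forall>x\<in>sphere_inf k. \<forall>e>0. \<exists>\<delta>>0. \<forall>y\<in>sphere_inf k.
      linf_norm k (x - y) < \<delta> \<longrightarrow> lp_norm k r (F x - F y) < e)"

definition cont_lp_inf :: "nat \<Rightarrow> real \<Rightarrow> ((nat \<Rightarrow> real) \<Rightarrow> (nat \<Rightarrow> real)) \<Rightarrow> bool" where
  "cont_lp_inf k r G \<longleftrightarrow> (\<forall>x\<in>sphere_lp k r. \<forall>e>0. \<exists>\<delta>>0. \<forall>y\<in>sphere_lp k r.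
      lp_norm k r (x - y) < \<delta> \<longrightarrow> linf_norm k (G x - G y) < e)"

definition homeo_inf_lp :: "nat \<Rightarrow> real \<Rightarrow> ((nat \<Rightarrow> real) \<Rightarrow> (nat \<Rightarrow> real)) \<Rightarrow> bool" where
  "homeo_inf_lp k r F \<longleftrightarrow> bij_betw F (sphere_inf k) (sphere_lp k r) \<and> cont_inf_lp k r F \<and>
      cont_lp_inf k r (inv_into (sphere_inf k) F)"

end

theory Submission
  imports Defs
begin

text \<open>
  Split the coordinates into blocks \<open>A\<^sub>0, \<dots>, A\<^sub>2\<^sub>d\<close> of geometrically growing size, except that \<open>A\<^sub>2\<^sub>d\<close> is
  a single coordinate, and join \<open>-1\<close> to \<open>1\<close> inside the sphere by vectors taking on \<open>A\<^sub>j\<close> the value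
  \<open>t - j/d\<close> clamped to \<open>[-1, 1]\<close>. A step preserving \<open>F\<close> maps the two constant vectors to opposite
  constant vectors, so at some point \<open>x\<close> of the path \<open>F x\<close> vanishes on the largest block \<open>A\<^sub>2\<^sub>d\<^sub>-\<^sub>1\<close>.
  Moving values of \<open>x\<close> by at most \<open>1/d\<close> one can merge either the pairs \<open>A\<^sub>0 \<union> A\<^sub>1, A\<^sub>2 \<union> A\<^sub>3, \<dots>\<close> or the
  pairs \<open>A\<^sub>1 \<union> A\<^sub>2, \<dots>, A\<^sub>2\<^sub>d\<^sub>-\<^sub>1 \<union> A\<^sub>2\<^sub>d\<close>. As \<open>F\<close> is constant on merged pairs, the smaller blocks of the
  pairs then carry norm at most \<open>1/19\<close>. But for one of the two mergings these blocks carry at least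
  half of the \<open>r\<close>-th power mass of \<open>F x\<close>, which forces \<open>F x\<close> to move by at least \<open>1/2\<close>.
\<close>

section \<open>Minkowski's inequality on a finite set of coordinates\<close>

text \<open>Indexing by a set of coordinates lets a vector be measured separately on a union of
  blocks and on its complement.\<close>

definition lp_norm_on :: "'a set \<Rightarrow> real \<Rightarrow> ('a \<Rightarrow> real) \<Rightarrow> real" where
  "lp_norm_on S r x = (\<Sum>i\<in>S. \<bar>x i\<bar> powr r) powr (1 / r)"

lemma lp_norm_eq: "lp_norm k r = lp_norm_on {..<k} r"
  by (simp add: fun_eq_iff lp_norm_def lp_norm_on_def)

lemma lp_norm_on_nonneg [simp]: "0 \<le> lp_norm_on S r x"
  by (simp add: lp_norm_on_def)

lemma lp_norm_on_powr: "1 \<le> r \<Longrightarrow> lp_norm_on S r x powr r = (\<Sum>i\<in>S. \<bar>x i\<bar> powr r)"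
  by (simp add: lp_norm_on_def powr_powr sum_nonneg)

lemma lp_norm_on_minus_commute: "lp_norm_on S r (x - y) = lp_norm_on S r (y - x)"
  by (simp add: lp_norm_on_def abs_minus_commute)

lemma lp_norm_on_mono_set:
  assumes "1 \<le> r" "finite T" "S \<subseteq> T"
  shows "lp_norm_on S r x \<le> lp_norm_on T r x"
  unfolding lp_norm_on_def using assms
  by (intro powr_mono2 sum_mono2) (auto intro: sum_nonneg)

lemma abs_le_lp_norm_on:
  assumes "1 \<le> r" "finite S" "i \<in> S"
  shows "\<bar>x i\<bar> \<le> lp_norm_on S r x"
proof -
  have "lp_norm_on {i} r x \<le> lp_norm_on S r x"
    using assms by (intro lp_norm_on_mono_set) auto
  then show ?thesis using assms by (simp add: lp_norm_on_def powr_powr)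
qed

lemma powr_le_self:
  fixes a r :: real
  assumes "0 \<le> a" "a \<le> 1" "1 \<le> r"
  shows "a powr r \<le> a"
  using assms powr_le_one_le[of a r] by (cases "a = 0") auto

text \<open>For positive \<open>a\<close> and \<open>b\<close> this is convexity of the power. If
  one of them is zero, it reduces to \<open>\<mu> powr r \<le> \<mu>\<close> for a weight between 0
  and 1.\<close>

lemma powr_convex_combination:
  fixes a b r :: real
  assumes "0 \<le> a" "0 \<le> b" "0 \<le> \<mu>" "0 \<le> \<nu>" "\<mu> + \<nu> = 1" "1 \<le> r"
  shows "(\<mu> * a + \<nu> * b) powr r \<le> \<mu> * a powr r + \<nu> * b powr r"
proof -
  have *: "(\<mu> * a) powr r \<le> \<mu> * a powr r" if "0 \<le> \<mu>" "\<mu> \<le> 1" "0 \<le> a" for \<mu> a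
    using that powr_le_self[of \<mu> r] assms by (simp add: powr_mult mult_right_mono)
  consider "a = 0" | "b = 0" | "0 < a" "0 < b" using assms by linarith
  then show ?thesis
  proof cases
    case 1 then show ?thesis using *[of \<nu> b] assms by simp
  next
    case 2 then show ?thesis using *[of \<mu> a] assms by simp
  next
    case 3
    have "\<mu> = 1 - \<nu>" using assms by simp
    then show ?thesis
      using 3 convex_onD[OF powr_convex[OF assms(6)], of \<nu> a b] assms(3,4) by simp
  qed
qed

text \<open>Minkowski's inequality by normalisation: with A and B the norms of \<open>x\<close> and
  \<open>y\<close>, the vector (x + y) / (A + B) is a convex combination of x / A and y / B, so
  convexity of the power can be applied in each coordinate and summed. If A or B is zero, that
  vector vanishes on \<open>S\<close>.\<close>

lemma lp_norm_on_triangle: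
  assumes r: "1 \<le> r" and S: "finite S"
  shows "lp_norm_on S r (\<lambda>i. x i + y i) \<le> lp_norm_on S r x + lp_norm_on S r y"
proof -
  define A B where "A = lp_norm_on S r x" and "B = lp_norm_on S r y"
  have nn: "0 \<le> A" "0 \<le> B" by (simp_all add: A_def B_def)
  have xA: "\<bar>x i\<bar> \<le> A" and yB: "\<bar>y i\<bar> \<le> B" if "i \<in> S" for i
    using abs_le_lp_norm_on r S that by (auto simp: A_def B_def)
  have sA: "(\<Sum>i\<in>S. \<bar>x i\<bar> powr r) = A powr r" and sB: "(\<Sum>i\<in>S. \<bar>y i\<bar> powr r) = B powr r"
    using r by (simp_all add: A_def B_def lp_norm_on_powr)
  consider "A = 0" | "B = 0" | "0 < A" "0 < B" using nn by linarith
  then show ?thesis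
  proof cases
    case 1
    then have "(\<Sum>i\<in>S. \<bar>x i + y i\<bar> powr r) = (\<Sum>i\<in>S. \<bar>y i\<bar> powr r)"
      using xA by (intro sum.cong) auto
    then show ?thesis by (simp add: lp_norm_on_def)
  next
    case 2
    then have "(\<Sum>i\<in>S. \<bar>x i + y i\<bar> powr r) = (\<Sum>i\<in>S. \<bar>x i\<bar> powr r)"
      using yB by (intro sum.cong) auto
    then show ?thesis by (simp add: lp_norm_on_def)
  next
    case 3
    define \<mu> \<nu> where "\<mu> = A / (A + B)" and "\<nu> = B / (A + B)"
    have mn: "0 \<le> \<mu>" "0 \<le> \<nu>" "\<mu> + \<nu> = 1"
      using 3 by (auto simp: \<mu>_def \<nu>_def simp flip: add_divide_distrib)
    have "\<bar>x i + y i\<bar> powr r \<le>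
        (A + B) powr r * (\<mu> * (\<bar>x i\<bar> powr r / A powr r) + \<nu> * (\<bar>y i\<bar> powr r / B powr r))" for i
    proof -
      have "\<bar>x i\<bar> + \<bar>y i\<bar> = (A + B) * (\<mu> * (\<bar>x i\<bar> / A) + \<nu> * (\<bar>y i\<bar> / B))"
        using 3 by (simp add: \<mu>_def \<nu>_def distrib_left)
      then have "(\<bar>x i\<bar> + \<bar>y i\<bar>) powr r
          = (A + B) powr r * (\<mu> * (\<bar>x i\<bar> / A) + \<nu> * (\<bar>y i\<bar> / B)) powr r"
        using 3 mn by (simp add: powr_mult)
      also have "\<dots> \<le> (A + B) powr r * (\<mu> * (\<bar>x i\<bar> / A) powr r + \<nu> * (\<bar>y i\<bar> / B) powr r)"
        using 3 mn r by (intro mult_left_mono powr_convex_combination) auto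
      finally have "(\<bar>x i\<bar> + \<bar>y i\<bar>) powr r
          \<le> (A + B) powr r * (\<mu> * (\<bar>x i\<bar> powr r / A powr r) + \<nu> * (\<bar>y i\<bar> powr r / B powr r))"
        using 3 by (simp add: powr_divide)
      moreover have "\<bar>x i + y i\<bar> powr r \<le> (\<bar>x i\<bar> + \<bar>y i\<bar>) powr r"
        using r by (intro powr_mono2) auto
      ultimately show ?thesis by (rule order_trans[rotated])
    qed
    then have "(\<Sum>i\<in>S. \<bar>x i + y i\<bar> powr r) \<le> (\<Sum>i\<in>S. (A + B) powr r *
        (\<mu> * (\<bar>x i\<bar> powr r / A powr r) + \<nu> * (\<bar>y i\<bar> powr r / B powr r)))"
      by (rule sum_mono)
    also have "\<dots> = (A + B) powr r *
        (\<mu> * ((\<Sum>i\<in>S. \<bar>x i\<bar> powr r) / A powr r) + \<nu> * ((\<Sum>i\<in>S. \<bar>y i\<bar> powr r) / B powr r))"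
      by (simp only: sum.distrib sum_divide_distrib flip: sum_distrib_left)
    also have "\<dots> = (A + B) powr r" using 3 mn by (simp add: sA sB)
    finally have "lp_norm_on S r (\<lambda>i. x i + y i) \<le> ((A + B) powr r) powr (1 / r)"
      unfolding lp_norm_on_def using r by (intro powr_mono2) (auto intro: sum_nonneg)
    also have "\<dots> = A + B" using 3 r by (simp add: powr_powr)
    finally show ?thesis by (simp add: A_def B_def)
  qed
qed

lemma lp_norm_on_triangle_diff:
  assumes "1 \<le> r" "finite S"
  shows "lp_norm_on S r x - lp_norm_on S r y \<le> lp_norm_on S r (x - y)"
  using lp_norm_on_triangle[OF assms, of "x - y" y] by (simp add: lp_norm_on_def)

section \<open>Separating two unit vectors by their mass on a subset\<close>

text \<open>Since \<open>v\<close> is small on \<open>S\<close>, its norm off \<open>S\<close> is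
  close to one, while \<open>u\<close> has at most half of its mass there. So the vectors differ
  both on \<open>S\<close> and off \<open>S\<close>.\<close>

lemma lp_norm_on_diff_ge_half:
  assumes r: "1 \<le> r" and T: "finite T" and ST: "S \<subseteq> T"
    and u: "(\<Sum>i\<in>T. \<bar>u i\<bar> powr r) = 1" and v: "(\<Sum>i\<in>T. \<bar>v i\<bar> powr r) = 1"
    and uS: "1 / 2 \<le> (\<Sum>i\<in>S. \<bar>u i\<bar> powr r)" and vS: "lp_norm_on S r v \<le> 1 / 19"
  shows "1 / 2 \<le> lp_norm_on T r (u - v)"
proof (rule ccontr)
  define D where "D = lp_norm_on T r (u - v)"
  assume "\<not> ?thesis"
  then have D: "D < 1 / 2" by (simp add: D_def)
  txt \<open>The part on \<open>S\<close> alone settles the case \<open>p \<ge> 1/2 + 1/19\<close>; otherwise \<open>r < 2\<close> and both parts contribute.\<close>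
  have fin: "finite S" "finite (T - S)" using T ST finite_subset by auto
  have split: "lp_norm_on S r x powr r + lp_norm_on (T - S) r x powr r
      = (\<Sum>i\<in>T. \<bar>x i\<bar> powr r)" for x
    using r sum.subset_diff[OF ST T, of "\<lambda>i. \<bar>x i\<bar> powr r"] by (simp add: lp_norm_on_powr)
  define p q a b \<alpha> \<beta> where "p = lp_norm_on S r u" and "q = lp_norm_on (T - S) r u"
    and "a = lp_norm_on S r v" and "b = lp_norm_on (T - S) r v"
    and "\<alpha> = lp_norm_on S r (u - v)" and "\<beta> = lp_norm_on (T - S) r (u - v)"
  note defs = this
  have nn: "0 \<le> p" "0 \<le> q" "0 \<le> a" "0 \<le> b" "0 \<le> \<alpha>" "0 \<le> \<beta>" by (simp_all add: defs)
  have pq: "p powr r + q powr r = 1" and ab: "a powr r + b powr r = 1"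
    and \<alpha>\<beta>: "\<alpha> powr r + \<beta> powr r = D powr r"
    using split[of u] split[of v] split[of "u - v"] u v r
    by (simp_all add: defs D_def lp_norm_on_powr)
  have p: "1 / 2 \<le> p powr r" using uS r by (simp add: defs lp_norm_on_powr)
  have a: "a \<le> 1 / 19" using vS by (simp add: defs)
  have \<alpha>: "p - a \<le> \<alpha>" "\<alpha> \<le> D"
    using lp_norm_on_triangle_diff[OF r fin(1), of u v] lp_norm_on_mono_set[OF r T ST, of "u - v"]
    by (simp_all add: defs D_def)
  have \<beta>: "b - q \<le> \<beta>"
    using lp_norm_on_triangle_diff[OF r fin(2), of v u] lp_norm_on_minus_commute[of "T - S" r u v]
    by (simp add: defs)
  \<comment> \<open>Both \<open>a powr r \<le> a\<close> and
    \<open>(1 - a) powr r \<le> 1 - a\<close> hold, so a smaller \<open>b\<close> would leave total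
    mass below one.\<close>
  have b: "1 - a \<le> b"
  proof (rule ccontr)
    assume "\<not> ?thesis"
    then have "b powr r < (1 - a) powr r" using r nn by (intro powr_less_mono2) auto
    also have "\<dots> \<le> 1 - a" using r a nn by (intro powr_le_self) auto
    finally show False using powr_le_self[of a r] a nn r ab by linarith
  qed
  have p_lt: "p < 21 / 38" using \<alpha> D a by linarith
  have p_ge: "1 / 2 \<le> p" using powr_le_self[of p r] p p_lt nn r by linarith
  \<comment> \<open>Here \<open>p\<close> is below 21/38 = 1/2 + 1/19, and the square of 21/38 is
    less than 1/2.\<close>
  have r2: "r < 2"
  proof (rule ccontr)
    assume "\<not> ?thesis"
    then have "p powr r \<le> p powr 2" using p_lt nn by (intro powr_mono') auto
    also have "\<dots> = p ^ 2" using p_ge by simp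
    also have "\<dots> \<le> (21 / 38) ^ 2" using p_lt nn by (intro power_mono) auto
    finally show False using p by (simp add: power2_eq_square)
  qed
  have "q \<le> p"
  proof (rule ccontr)
    assume "\<not> ?thesis"
    then have "p powr r < q powr r" using r nn by (intro powr_less_mono2) auto
    then show False using p pq by linarith
  qed
  \<comment> \<open>Doubling a number of [0, 1/2] lands in [0, 1], where lowering the exponent from
    2 to \<open>r\<close> can only raise the power.\<close>
  have lower: "(2 * c) ^ 2 \<le> (2 * w) powr r" if "0 < c" "c \<le> w" "w \<le> 1 / 2" for c w
  proof -
    have "(2 * c) ^ 2 \<le> (2 * w) ^ 2" using that by (intro power_mono) auto
    also have "\<dots> = (2 * w) powr 2" using that by simp
    also have "\<dots> \<le> (2 * w) powr r" using r2 that by (intro powr_mono') auto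
    finally show ?thesis .
  qed
  have \<beta>D: "\<beta> \<le> D"
    using lp_norm_on_mono_set[OF r T, of "T - S" "u - v"] by (simp add: defs D_def)
  \<comment> \<open>17/38 = 1/2 - 1/19 bounds \<open>p - a\<close>, and 15/38 = 18/19 - 21/38 bounds
    \<open>b - q\<close>. The two squares add up to more than 1, whereas
    \<open>(2 * D) powr r\<close> is at most 1.\<close>
  have "(2 * (17 / 38)) ^ 2 \<le> (2 * \<alpha>) powr r" "(2 * (15 / 38)) ^ 2 \<le> (2 * \<beta>) powr r"
    using p_ge p_lt a \<alpha> \<beta> b \<beta>D D \<open>q \<le> p\<close> by (intro lower; linarith)+
  moreover have "(2 * \<alpha>) powr r + (2 * \<beta>) powr r = 2 powr r * (\<alpha> powr r + \<beta> powr r)"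
    using nn by (simp add: powr_mult distrib_left)
  moreover have "2 powr r * D powr r = (2 * D) powr r"
    using order_trans[OF nn(5) \<alpha>(2)] by (simp add: powr_mult)
  moreover have "(2 * D) powr r \<le> 1"
    using powr_mono2[of r "2 * D" 1] D r order_trans[OF nn(5) \<alpha>(2)] by simp
  ultimately show False unfolding \<alpha>\<beta> by (simp add: power2_eq_square)
qed

section \<open>Comparing sums by counting in fibres\<close>

text \<open>The weight is constant on each fibre of \<open>g\<close>, so sums inside a fibre are
  proportional to cardinalities, and the counting hypothesis can be added up over the
  fibres.\<close>

lemma sum_le_of_sparse_in_fibres:
  fixes w :: "'a \<Rightarrow> real"
  assumes T: "finite T" and ST: "S \<subseteq> T"
    and w: "\<And>i. i \<in> T \<Longrightarrow> 0 \<le> w i"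
    and const: "\<And>i j. i \<in> T \<Longrightarrow> j \<in> T \<Longrightarrow> g i = g j \<Longrightarrow> w i = w j"
    and sparse: "\<And>m. m \<in> g ` T \<Longrightarrow> c * card {i\<in>S. g i = m} \<le> card {i\<in>T. g i = m}"
  shows "real c * (\<Sum>i\<in>S. w i) \<le> (\<Sum>i\<in>T. w i)"
proof -
  have S: "finite S" using T ST finite_subset by auto
  have "real c * (\<Sum>i\<in>S. w i) = (\<Sum>m\<in>g ` T. real c * (\<Sum>i\<in>{i\<in>S. g i = m}. w i))"
    using sum.group[OF S finite_imageI[OF T] image_mono[OF ST, of g], where h = w]
    by (simp flip: sum_distrib_left)
  also have "\<dots> \<le> (\<Sum>m\<in>g ` T. \<Sum>i\<in>{i\<in>T. g i = m}. w i)"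
  proof (rule sum_mono)
    fix m assume m: "m \<in> g ` T"
    then obtain j where j: "j \<in> T" "g j = m" by auto
    have eq: "(\<Sum>i\<in>{i\<in>U. g i = m}. w i) = card {i\<in>U. g i = m} * w j" if "U \<subseteq> T" for U
    proof -
      have "w i = w j" if "i \<in> {i\<in>U. g i = m}" for i
        using that j \<open>U \<subseteq> T\<close> by (intro const) auto
      then show ?thesis using sum.cong[of _ _ w "\<lambda>_. w j"] by simp
    qed
    have "real c * card {i\<in>S. g i = m} * w j \<le> card {i\<in>T. g i = m} * w j"
      using sparse[OF m] w[OF j(1)]
      by (intro mult_right_mono) (simp_all flip: of_nat_mult)
    then show "real c * (\<Sum>i\<in>{i\<in>S. g i = m}. w i) \<le> (\<Sum>i\<in>{i\<in>T. g i = m}. w i)"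
      by (simp add: eq ST mult.assoc)
  qed
  also have "\<dots> = (\<Sum>i\<in>T. w i)" by (rule sum.image_gen[OF T, symmetric])
  finally show ?thesis .
qed

section \<open>The sup-norm sphere and the modulus of continuity\<close>

lemma linf_norm_le_iff: "linf_norm k x \<le> c \<longleftrightarrow> 0 \<le> c \<and> (\<forall>i<k. \<bar>x i\<bar> \<le> c)"
  by (auto simp: linf_norm_def)

lemma sphere_infI:
  assumes "vec_on k x" "\<And>i. i < k \<Longrightarrow> \<bar>x i\<bar> \<le> 1" "i < k" "\<bar>x i\<bar> = 1"
  shows "x \<in> sphere_inf k"
proof -
  have "linf_norm k x \<le> 1" using assms by (simp add: linf_norm_le_iff)
  moreover have "1 \<le> linf_norm k x"
    using assms(4) linf_norm_le_iff[of k x "linf_norm k x"] assms(3) by force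
  ultimately show ?thesis using assms(1) by (simp add: sphere_inf_def)
qed

lemma const_vec_in_sphere_inf: "1 \<le> k \<Longrightarrow> \<bar>c\<bar> = 1 \<Longrightarrow> const_vec k c \<in> sphere_inf k"
  by (rule sphere_infI[of _ _ 0]) (auto simp: const_vec_def vec_on_def)

text \<open>The real \<open>Sup\<close> in \<open>modulus\<close> is a genuine least upper bound
  only for a bounded set. Images are unit vectors, so their distances are at most 2.\<close>

lemma bdd_above_modulus:
  assumes "1 \<le> r" "F ` sphere_inf k \<subseteq> sphere_lp k r"
  shows "bdd_above {lp_norm k r (F x - F y) | x y.
      x \<in> sphere_inf k \<and> y \<in> sphere_inf k \<and> linf_norm k (x - y) \<le> t}"
proof (rule bdd_aboveI[of _ 2], clarify)
  fix x y assume "x \<in> sphere_inf k" "y \<in> sphere_inf k"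
  then have "lp_norm k r (F x) = 1" "lp_norm k r (F y) = 1"
    using assms(2) by (auto simp: sphere_lp_def)
  moreover have "lp_norm_on {..<k} r (\<lambda>i. - F y i) = lp_norm_on {..<k} r (F y)"
    by (simp add: lp_norm_on_def)
  moreover have "F x - F y = (\<lambda>i. F x i + (- F y i))" by auto
  ultimately show "lp_norm k r (F x - F y) \<le> 2"
    using lp_norm_on_triangle[OF assms(1), of "{..<k}" "F x" "\<lambda>i. - F y i"]
    by (simp add: lp_norm_eq)
qed

lemma lp_norm_diff_le_modulus:
  assumes "1 \<le> r" "F ` sphere_inf k \<subseteq> sphere_lp k r"
    and "x \<in> sphere_inf k" "y \<in> sphere_inf k" "linf_norm k (x - y) \<le> t"
  shows "lp_norm k r (F x - F y) \<le> modulus k r F t"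
  unfolding modulus_def using bdd_above_modulus[OF assms(1,2)] assms(3-5)
  by (intro cSup_upper) auto

lemma modulus_mono:
  assumes "1 \<le> r" "1 \<le> k" "F ` sphere_inf k \<subseteq> sphere_lp k r" "0 \<le> s" "s \<le> t"
  shows "modulus k r F s \<le> modulus k r F t"
  unfolding modulus_def
proof (rule cSup_subset_mono)
  \<comment> \<open>Comparing suprema needs a nonempty smaller set; a constant vector paired with
    itself is a member.\<close>
  have "linf_norm k (const_vec k 1 - const_vec k 1) \<le> s"
    using assms by (simp add: linf_norm_le_iff)
  moreover have "const_vec k 1 \<in> sphere_inf k" using assms by (simp add: const_vec_in_sphere_inf)
  ultimately show "{lp_norm k r (F x - F y) | x y.
      x \<in> sphere_inf k \<and> y \<in> sphere_inf k \<and> linf_norm k (x - y) \<le> s} \<noteq> {}" by blast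
  show "bdd_above {lp_norm k r (F x - F y) | x y.
      x \<in> sphere_inf k \<and> y \<in> sphere_inf k \<and> linf_norm k (x - y) \<le> t}"
    using assms by (intro bdd_above_modulus)
  show "{lp_norm k r (F x - F y) | x y.
      x \<in> sphere_inf k \<and> y \<in> sphere_inf k \<and> linf_norm k (x - y) \<le> s}
    \<subseteq> {lp_norm k r (F x - F y) | x y.
      x \<in> sphere_inf k \<and> y \<in> sphere_inf k \<and> linf_norm k (x - y) \<le> t}"
    using assms by fastforce
qed

section \<open>Blocks of geometrically growing size\<close>

text \<open>Level 0 is the index 0, and for j < n the levels up to j together are the first M^j
  indices. Level \<open>n\<close> takes all further indices except the last, which alone is level
  \<open>n + 1\<close>. So the smaller of two neighbouring levels is at most a 1/M part of their
  union.\<close>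

lemma geometric_levels:
  fixes M n k :: nat
  assumes M: "2 \<le> M" and n: "1 \<le> n" and k: "M ^ n + 1 \<le> k"
  obtains lev :: "nat \<Rightarrow> nat" where
    "\<And>i. lev i \<le> n + 1"
    "\<And>j. j \<le> n + 1 \<Longrightarrow> \<exists>i<k. lev i = j"
    "\<And>j. j < n \<Longrightarrow> M * card {i. i < k \<and> lev i = j}
        \<le> card {i. i < k \<and> lev i = j} + card {i. i < k \<and> lev i = j + 1}"
    "M * card {i. i < k \<and> lev i = n + 1}
        \<le> card {i. i < k \<and> lev i = n} + card {i. i < k \<and> lev i = n + 1}"
proof -
  define lev where
    \<comment> \<open>The \<open>min\<close> puts all surplus indices into level
      \<open>n\<close>.\<close>
    "lev i = (if i = k - 1 then n + 1 else min n (LEAST j. i < M ^ j))" for i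
  \<comment> \<open>The levels up to \<open>j\<close> form the initial segment of length
    \<open>cut j\<close>; for \<open>j = n\<close> it reaches up to the reserved last index.\<close>
  define cut where "cut j = (if j = n then k - 1 else M ^ j)" for j
  have least: "(LEAST j. i < M ^ j) \<le> j \<longleftrightarrow> i < M ^ j" for i j
  proof
    assume le: "(LEAST j. i < M ^ j) \<le> j"
    have "i < M ^ i" using M by (intro power_gt_expt) simp
    then have "i < M ^ (LEAST j. i < M ^ j)" by (rule LeastI)
    also have "\<dots> \<le> M ^ j" using M le by (intro power_increasing) auto
    finally show "i < M ^ j" .
  qed (rule Least_le)
  have Mj: "M ^ j \<le> cut j" "cut j \<le> k - 1" if "j \<le> n" for j
  proof -
    have "M ^ j \<le> M ^ n" using that M by (intro power_increasing) auto
    then show "M ^ j \<le> cut j" "cut j \<le> k - 1" using k by (auto simp: cut_def)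
  qed
  have lev_le: "i < k \<and> lev i \<le> j \<longleftrightarrow> i < cut j" if "j \<le> n" for i j
    using that least[of i j] Mj[OF that] by (auto simp: lev_def cut_def min_le_iff_disj)
  have set0: "{i. i < k \<and> lev i = 0} = {..<1}"
    using lev_le[of 0] n by (auto simp: cut_def)
  have setS: "{i. i < k \<and> lev i = j + 1} = {M ^ j..<cut (j + 1)}" if "j < n" for j
  proof -
    have "i < k \<and> lev i = j + 1 \<longleftrightarrow> M ^ j \<le> i \<and> i < cut (j + 1)" for i
    proof -
      have "i < k \<and> lev i = j + 1 \<longleftrightarrow> (i < k \<and> lev i \<le> j + 1) \<and> \<not> (i < k \<and> lev i \<le> j)"
        by auto
      also have "\<dots> \<longleftrightarrow> M ^ j \<le> i \<and> i < cut (j + 1)"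
        using that by (subst (1 2) lev_le) (auto simp: cut_def)
      finally show ?thesis .
    qed
    then show ?thesis unfolding set_eq_iff mem_Collect_eq atLeastLessThan_iff by blast
  qed
  have setn: "{i. i < k \<and> lev i = n + 1} = {k - 1}"
    using k by (auto simp: lev_def)
  have card_ge: "M * M ^ j - M ^ j \<le> card {i. i < k \<and> lev i = j + 1}" if "j < n" for j
    using that Mj[of "j + 1"] by (subst setS) auto
  have card_eq: "card {i. i < k \<and> lev i = j + 1} = M * M ^ j - M ^ j" if "j + 1 < n" for j
    using that by (subst setS) (auto simp: cut_def)
  have ge: "M - 1 \<le> card {i. i < k \<and> lev i = j + 1}" if "j < n" for j
  proof -
    have "(M - 1) * 1 \<le> (M - 1) * M ^ j" using M by (intro mult_le_mono) auto
    then show ?thesis using card_ge[OF that] by (simp add: diff_mult_distrib)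
  qed
  show thesis
  proof (rule that)
    show "lev i \<le> n + 1" for i by (simp add: lev_def min_def)
    show "\<exists>i<k. lev i = j" if j: "j \<le> n + 1" for j
    proof -
      have "{i. i < k \<and> lev i = j} \<noteq> {}"
      proof (cases "j = 0")
        case True then show ?thesis using set0 by auto
      next
        case False
        then obtain j' where j': "j = j' + 1" using Suc_eq_plus1 not0_implies_Suc by metis
        show ?thesis
        proof (cases "j' = n")
          case True then show ?thesis using setn j' by auto
        next
          case False
          then have "0 < card {i. i < k \<and> lev i = j}"
            unfolding j' using ge[of j'] j j' M by linarith
          then show ?thesis unfolding card_gt_0_iff by (rule conjunct1)
        qed
      qed
      then show ?thesis by auto
    qed
    show "M * card {i. i < k \<and> lev i = j}
        \<le> card {i. i < k \<and> lev i = j} + card {i. i < k \<and> lev i = j + 1}" if "j < n" for j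
    proof (cases "j = 0")
      case True then show ?thesis using ge[of 0] n set0 by simp
    next
      case False
      then obtain j' where j': "j = j' + 1" using Suc_eq_plus1 not0_implies_Suc by metis
      then show ?thesis using card_eq[of j'] card_ge[of j] that
        by (simp add: diff_mult_distrib2)
    qed
    show "M * card {i. i < k \<and> lev i = n + 1}
        \<le> card {i. i < k \<and> lev i = n} + card {i. i < k \<and> lev i = n + 1}"
      using ge[of "n - 1"] n setn by simp
  qed
qed

section \<open>A zero coordinate along the path\<close>

text \<open>Both constant vectors have constant images, whose entries have absolute value k^(-1/r)
  because the norm is one. Distinct images are therefore opposite, and the intermediate value
  theorem applies to coordinate \<open>i\<close> along the path.\<close>

lemma step_map_zero_coordinate:
  assumes r: "1 \<le> r" and i: "i < k" and ab: "a \<le> b"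
    and F: "F ` sphere_inf k \<subseteq> sphere_lp k r" "step_preserving k F" "cont_inf_lp k r F"
    and ne: "F (const_vec k 1) \<noteq> F (const_vec k (-1))"
    and p: "\<And>t. p t \<in> sphere_inf k" "p a = const_vec k (-1)" "p b = const_vec k 1"
    and lip: "\<And>s t. linf_norm k (p s - p t) \<le> \<bar>s - t\<bar>"
  obtains t where "F (p t) i = 0"
proof -
  have coord: "\<bar>F x i - F y i\<bar> \<le> lp_norm k r (F x - F y)" for x y
    using abs_le_lp_norm_on[OF r, of "{..<k}" i "F x - F y"] i by (simp add: lp_norm_eq)
  have cont: "continuous_on {a..b} (\<lambda>t. F (p t) i)"
    unfolding continuous_on_iff
  proof (intro ballI allI impI)
    fix t e :: real assume "0 < e"
    then obtain \<delta> where \<delta>: "0 < \<delta>"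
      "\<forall>y\<in>sphere_inf k. linf_norm k (p t - y) < \<delta> \<longrightarrow> lp_norm k r (F (p t) - F y) < e"
      using F(3) p(1) unfolding cont_inf_lp_def by blast
    have "dist (F (p s) i) (F (p t) i) < e" if "dist s t < \<delta>" for s
    proof -
      have "linf_norm k (p t - p s) < \<delta>" using lip[of t s] that by (simp add: dist_real_def)
      then show ?thesis using \<delta>(2) p(1) coord[of "p t" "p s"] by (fastforce simp: dist_real_def)
    qed
    then show "\<exists>\<delta>>0. \<forall>s\<in>{a..b}. dist s t < \<delta> \<longrightarrow> dist (F (p s) i) (F (p t) i) < e"
      using \<delta>(1) by blast
  qed
  have const: "F (const_vec k c) j = (if j < k then F (const_vec k c) i else 0)"
    and unit: "real k * \<bar>F (const_vec k c) i\<bar> powr r = 1" if "\<bar>c\<bar> = 1" for c j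
  proof -
    have c: "const_vec k c \<in> sphere_inf k" using that i by (intro const_vec_in_sphere_inf) auto
    then have vec: "vec_on k (F (const_vec k c))" and norm: "lp_norm k r (F (const_vec k c)) = 1"
      using F(1) by (auto simp: sphere_lp_def)
    have eq: "F (const_vec k c) j = F (const_vec k c) i" if "j < k" for j
    proof -
      have "const_vec k c j = const_vec k c i" using that i by (simp add: const_vec_def)
      then show ?thesis using F(2) c i that unfolding step_preserving_def by blast
    qed
    then show "F (const_vec k c) j = (if j < k then F (const_vec k c) i else 0)"
      using vec by (auto simp: vec_on_def)
    have "(\<Sum>j<k. \<bar>F (const_vec k c) j\<bar> powr r) = (\<Sum>j<k. \<bar>F (const_vec k c) i\<bar> powr r)"
      by (intro sum.cong refl) (metis eq lessThan_iff)
    then show "real k * \<bar>F (const_vec k c) i\<bar> powr r = 1"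
      using lp_norm_on_powr[OF r, of "{..<k}" "F (const_vec k c)"] norm
      by (simp add: lp_norm_eq)
  qed
  have "F (const_vec k 1) i \<noteq> F (const_vec k (-1)) i"
  proof
    assume "F (const_vec k 1) i = F (const_vec k (-1)) i"
    then have "F (const_vec k 1) j = F (const_vec k (-1)) j" for j
      by (subst (1 2) const) simp_all
    then show False using ne by auto
  qed
  moreover have "\<bar>F (const_vec k 1) i\<bar> = \<bar>F (const_vec k (-1)) i\<bar>"
  proof -
    have "\<bar>F (const_vec k 1) i\<bar> powr r = \<bar>F (const_vec k (-1)) i\<bar> powr r"
    proof -
      have "real k * \<bar>F (const_vec k 1) i\<bar> powr r = real k * \<bar>F (const_vec k (-1)) i\<bar> powr r"
        using unit[of 1] unit[of "-1"] by simp
      then show ?thesis using i by simp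
    qed
    then have "(\<bar>F (const_vec k 1) i\<bar> powr r) powr (1 / r)
        = (\<bar>F (const_vec k (-1)) i\<bar> powr r) powr (1 / r)" by (simp only:)
    then show ?thesis using r by (simp add: powr_powr)
  qed
  ultimately have opp: "F (p b) i = - F (p a) i" using p by (auto simp: abs_if split: if_splits)
  show thesis
  proof (cases "F (p a) i \<le> 0")
    case True
    then show ?thesis
      using IVT'[OF _ _ ab cont, of 0] opp that by auto
  next
    case False
    then show ?thesis
      using IVT2'[OF _ _ ab cont, of 0] opp that by auto
  qed
qed

section \<open>Merging neighbouring blocks\<close>

lemma step_map_modulus_ge_half:
  assumes r: "1 \<le> r" and d: "1 \<le> d" and k: "nat \<lceil>19 powr r\<rceil> ^ (2 * d - 1) + 1 \<le> k"
    and F: "F ` sphere_inf k \<subseteq> sphere_lp k r" "step_preserving k F" "cont_inf_lp k r F"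
    and ne: "F (const_vec k 1) \<noteq> F (const_vec k (-1))"
  shows "1 / 2 \<le> modulus k r F (1 / real d)"
proof -
  \<comment> \<open>With this ratio, a set carrying mass at most 1/M carries norm at most
    1/19.\<close>
  define M where "M = nat \<lceil>19 powr r\<rceil>"
  have M_ge: "19 powr r \<le> real M" unfolding M_def by linarith
  have "(19::real) powr 1 \<le> 19 powr r" using r by (intro powr_mono) auto
  with M_ge have M19: "19 \<le> real M" by simp
  have n: "1 \<le> 2 * d - 1" "2 * d - 1 + 1 = 2 * d" using d by auto
  obtain lev :: "nat \<Rightarrow> nat" where lev_le: "\<And>i. lev i \<le> 2 * d"
    and lev_ex: "\<And>j. j \<le> 2 * d \<Longrightarrow> \<exists>i<k. lev i = j"
    and lev_card: "\<And>j. j < 2 * d - 1 \<Longrightarrow> M * card {i. i < k \<and> lev i = j}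
        \<le> card {i. i < k \<and> lev i = j} + card {i. i < k \<and> lev i = j + 1}"
    and lev_last: "M * card {i. i < k \<and> lev i = 2 * d}
        \<le> card {i. i < k \<and> lev i = 2 * d - 1} + card {i. i < k \<and> lev i = 2 * d}"
    using geometric_levels[of M "2 * d - 1" k] k M19 n(1) unfolding n(2) M_def by auto
  define profile where "profile h = (\<lambda>i. if i < k then h (lev i) else 0)" for h :: "nat \<Rightarrow> real"
  txt \<open>Larger levels carry smaller values of \<open>\<phi> t\<close>; some value is always \<open>\<plusminus>1\<close>: level \<open>0\<close> has value
    \<open>1\<close> if \<open>t \<ge> 1\<close>, and level \<open>2 * d\<close> has value \<open>-1\<close> if \<open>t \<le> 1\<close>.\<close>
  define \<phi> where "\<phi> t j = max (-1) (min 1 (t - real j / real d))" for t j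
  have \<phi>_lip_t: "\<bar>\<phi> s j - \<phi> t j\<bar> \<le> \<bar>s - t\<bar>" for s t j
    unfolding \<phi>_def by linarith
  have \<phi>_lip_j: "\<bar>\<phi> t i - \<phi> t j\<bar> \<le> 1 / real d" if "i \<le> j + 1" "j \<le> i + 1" for t i j
  proof -
    have "real i / real d \<le> (real j + 1) / real d" "real j / real d \<le> (real i + 1) / real d"
      using that by (intro divide_right_mono; simp)+
    then show ?thesis unfolding \<phi>_def add_divide_distrib by linarith
  qed
  \<comment> \<open>For \<open>s\<close> the identity this is the path itself; for
    \<open>s j = 2 * g j\<close> it is the merged vector. Fixing the two extreme levels preserves a
    value of modulus one.\<close>
  have sphere: "profile (\<lambda>j. \<phi> t (s j)) \<in> sphere_inf k" if s: "s 0 = 0" "s (2 * d) = 2 * d" for t s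
  proof -
    obtain i0 i1 where i: "i0 < k" "lev i0 = 0" "i1 < k" "lev i1 = 2 * d"
      using lev_ex[of 0] lev_ex[of "2 * d"] by auto
    have "\<bar>profile (\<lambda>j. \<phi> t (s j)) (if 1 \<le> t then i0 else i1)\<bar> = 1"
      using i s d by (auto simp: profile_def \<phi>_def)
    then show ?thesis
      using i by (intro sphere_infI[of k _ "if 1 \<le> t then i0 else i1"])
        (auto simp: profile_def \<phi>_def vec_on_def)
  qed
  have profile_dist: "linf_norm k (profile g - profile h) \<le> c"
    if "\<And>j. \<bar>g j - h j\<bar> \<le> c" for g h c
    using that order_trans[OF abs_ge_zero that] by (auto simp: linf_norm_le_iff profile_def)
  have step: "F x i = F x j" if "x \<in> sphere_inf k" "i < k" "j < k" "x i = x j" for x i j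
    using F(2) that unfolding step_preserving_def by blast
  have unit: "(\<Sum>i<k. \<bar>F x i\<bar> powr r) = 1" if "x \<in> sphere_inf k" for x
    using F(1) that lp_norm_on_powr[OF r, of "{..<k}" "F x"]
    by (auto simp: sphere_lp_def lp_norm_eq)

  \<comment> \<open>Level \<open>2 * d - 1\<close> is the one level that is not the smaller member
    of a pair in either merging.\<close>
  obtain iL where iL: "iL < k" "lev iL = 2 * d - 1" using lev_ex[of "2 * d - 1"] by auto
  \<comment> \<open>The shifts j/d lie in [0, 2], so at -1 every value is clamped to -1 and at 3
    every value is clamped to 1.\<close>
  have ends: "profile (\<phi> (-1)) = const_vec k (-1)" "profile (\<phi> 3) = const_vec k 1"
  proof -
    have "real (lev i) / real d \<le> 2" for i
      using lev_le[of i] d by (simp add: divide_le_eq flip: of_nat_mult)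
    then have "\<phi> 3 (lev i) = 1" for i unfolding \<phi>_def by (smt (verit))
    then show "profile (\<phi> 3) = const_vec k 1" by (auto simp: profile_def const_vec_def)
    have "0 \<le> real j / real d" for j by simp
    then have "\<phi> (-1) j = -1" for j unfolding \<phi>_def by (smt (verit))
    then show "profile (\<phi> (-1)) = const_vec k (-1)" by (auto simp: profile_def const_vec_def)
  qed
  obtain t where t: "F (profile (\<phi> t)) iL = 0"
    using step_map_zero_coordinate[OF r iL(1) _ F ne, of "-1" 3 "\<lambda>t. profile (\<phi> t)"]
      sphere[of "\<lambda>j. j"] ends profile_dist \<phi>_lip_t by auto
  define x where "x = profile (\<phi> t)"
  have x: "x \<in> sphere_inf k" using sphere[of "\<lambda>j. j" t] by (simp add: x_def)

  \<comment> \<open>The map \<open>g\<close> numbers the merged groups. Level \<open>j\<close> takes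
    over the value of the even level \<open>2 * g j\<close>, at most one step away, so values move
    by at most 1/d.\<close>
  have merge: ?thesis
    if S: "S \<subseteq> {..<k}" and mass: "1 / 2 \<le> (\<Sum>i\<in>S. \<bar>F x i\<bar> powr r)"
      and g: "g 0 = 0" "g (2 * d) = d" "\<And>j. 2 * g j \<le> j + 1" "\<And>j. j \<le> 2 * g j + 1"
      and sparse: "\<And>m. m \<le> d \<Longrightarrow>
        M * card {i\<in>S. g (lev i) = m} \<le> card {i\<in>{..<k}. g (lev i) = m}"
    for S g
  proof -
    define y where "y = profile (\<lambda>j. \<phi> t (2 * g j))"
    have y: "y \<in> sphere_inf k" unfolding y_def using g by (intro sphere) auto
    have xy: "linf_norm k (x - y) \<le> 1 / real d"
      unfolding x_def y_def using g by (intro profile_dist \<phi>_lip_j) auto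
    have const: "\<bar>F y i\<bar> powr r = \<bar>F y j\<bar> powr r"
      if "i \<in> {..<k}" "j \<in> {..<k}" "g (lev i) = g (lev j)" for i j
      using that step[OF y, of i j] by (auto simp: y_def profile_def)
    have m_le: "m \<le> d" if "m \<in> (\<lambda>i. g (lev i)) ` {..<k}" for m
    proof -
      from that obtain i where "m = g (lev i)" by blast
      then show ?thesis using g(3)[of "lev i"] lev_le[of i] by linarith
    qed
    have "real M * (\<Sum>i\<in>S. \<bar>F y i\<bar> powr r) \<le> (\<Sum>i\<in>{..<k}. \<bar>F y i\<bar> powr r)"
    proof (rule sum_le_of_sparse_in_fibres[OF _ S])
      show "M * card {i\<in>S. g (lev i) = m} \<le> card {i\<in>{..<k}. g (lev i) = m}"
        if "m \<in> (\<lambda>i. g (lev i)) ` {..<k}" for m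
        using that by (intro sparse m_le)
    qed (simp, simp, rule const)
    then have "(\<Sum>i\<in>S. \<bar>F y i\<bar> powr r) \<le> 1 / real M"
      using unit[OF y] M19 by (simp add: field_simps)
    also have "\<dots> \<le> 1 / 19 powr r"
      using M_ge M19 by (intro divide_left_mono) auto
    also have "\<dots> = (1 / 19) powr r" by (simp add: powr_divide)
    finally have "lp_norm_on S r (F y) \<le> ((1 / 19) powr r) powr (1 / r)"
      unfolding lp_norm_on_def using r by (intro powr_mono2) (auto intro: sum_nonneg)
    also have "\<dots> = 1 / 19" using r by (simp add: powr_powr)
    finally have "1 / 2 \<le> lp_norm_on {..<k} r (F x - F y)"
      using unit[OF x] unit[OF y] S mass r by (intro lp_norm_on_diff_ge_half) auto
    also have "\<dots> \<le> modulus k r F (1 / real d)"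
      using lp_norm_diff_le_modulus[OF r F(1) x y xy] by (simp add: lp_norm_eq)
    finally show ?thesis .
  qed

  define A where "A j = {i. i < k \<and> lev i = j}" for j
  have finA: "finite (A j)" for j by (simp add: A_def)
  have card_A2: "card (A i \<union> A j) = card (A i) + card (A j)" if "i \<noteq> j" for i j
    using that by (intro card_Un_disjoint finA) (auto simp: A_def)
  \<comment> \<open>\<open>E\<close> collects the smaller levels of the pairs (2m, 2m+1), and
    \<open>O'\<close> those of the pairs (2m-1, 2m), where in the last pair the singleton
    \<open>2 * d\<close> is the smaller one. Only level \<open>2 * d - 1\<close> is left out, and
    there \<open>F x\<close> vanishes.\<close>
  define E where "E = {i. i < k \<and> even (lev i) \<and> lev i < 2 * d}"
  define O' where "O' = {i. i < k \<and> (odd (lev i) \<and> lev i < 2 * d - 1 \<or> lev i = 2 * d)}"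
  have "(\<Sum>i<k. \<bar>F x i\<bar> powr r) = (\<Sum>i\<in>E \<union> O'. \<bar>F x i\<bar> powr r)"
  proof (rule sum.mono_neutral_right)
    show "\<forall>i\<in>{..<k} - (E \<union> O'). \<bar>F x i\<bar> powr r = 0"
    proof
      fix i assume "i \<in> {..<k} - (E \<union> O')"
      then have i: "i < k" "odd (lev i)" "\<not> lev i < 2 * d - 1" "lev i \<noteq> 2 * d"
        using lev_le[of i] by (auto simp: E_def O'_def)
      then have "lev i = lev iL" using lev_le[of i] iL by linarith
      then have "F x i = F x iL" using i iL by (intro step x) (auto simp: x_def profile_def)
      then show "\<bar>F x i\<bar> powr r = 0" using t by (simp add: x_def)
    qed
  qed (auto simp: E_def O'_def)
  also have "\<dots> = (\<Sum>i\<in>E. \<bar>F x i\<bar> powr r) + (\<Sum>i\<in>O'. \<bar>F x i\<bar> powr r)"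
    by (intro sum.union_disjoint) (auto simp: E_def O'_def)
  finally consider "1 / 2 \<le> (\<Sum>i\<in>E. \<bar>F x i\<bar> powr r)" | "1 / 2 \<le> (\<Sum>i\<in>O'. \<bar>F x i\<bar> powr r)"
    using unit[OF x] by linarith
  then show ?thesis
  proof cases
    case 1
    show ?thesis
    proof (rule merge[OF _ 1, of "\<lambda>j. j div 2"])
      fix m assume "m \<le> d"
      show "M * card {i\<in>E. lev i div 2 = m} \<le> card {i\<in>{..<k}. lev i div 2 = m}"
      proof (cases "m < d")
        case True
        have "{i\<in>E. lev i div 2 = m} = A (2 * m)"
          using True by (auto simp: E_def A_def)
        moreover have "M * card (A (2 * m)) \<le> card (A (2 * m)) + card (A (2 * m + 1))"
          using lev_card[of "2 * m"] True unfolding A_def by auto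
        moreover have "card (A (2 * m) \<union> A (2 * m + 1)) \<le> card {i\<in>{..<k}. lev i div 2 = m}"
          by (intro card_mono) (auto simp: A_def)
        ultimately show ?thesis using card_A2[of "2 * m" "2 * m + 1"] by simp
      next
        case False
        \<comment> \<open>For \<open>m = d\<close> the group is level \<open>2 * d\<close> alone,
          which is not in \<open>E\<close>.\<close>
        then have "{i\<in>E. lev i div 2 = m} = {}" by (auto simp: E_def)
        then show ?thesis by (simp only:) simp
      qed
    qed (auto simp: E_def)
  next
    case 2
    show ?thesis
    proof (rule merge[OF _ 2, of "\<lambda>j. (j + 1) div 2"])
      fix m assume "m \<le> d"
      then consider "m = 0" | "1 \<le> m" "m < d" | "m = d" by linarith
      then show "M * card {i\<in>O'. (lev i + 1) div 2 = m} \<le> card {i\<in>{..<k}. (lev i + 1) div 2 = m}"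
      proof cases
        case 1
        \<comment> \<open>Level 0 stays unpaired in this merging.\<close>
        then have "{i\<in>O'. (lev i + 1) div 2 = m} = {}" using d by (auto simp: O'_def)
        then show ?thesis by (simp only:) simp
      next
        case 2
        then have "{i\<in>O'. (lev i + 1) div 2 = m} = A (2 * m - 1)"
          by (auto simp: O'_def A_def elim!: oddE)
        moreover have "2 * m - 1 < 2 * d - 1" "2 * m - 1 + 1 = 2 * m" using 2 by auto
        then have "M * card (A (2 * m - 1)) \<le> card (A (2 * m - 1)) + card (A (2 * m))"
          using lev_card[of "2 * m - 1"] unfolding A_def by metis
        moreover have "card (A (2 * m - 1) \<union> A (2 * m)) \<le> card {i\<in>{..<k}. (lev i + 1) div 2 = m}"
          using 2 by (intro card_mono) (auto simp: A_def)
        ultimately show ?thesis using card_A2[of "2 * m - 1" "2 * m"] 2 by simp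
      next
        case 3
        then have "{i\<in>O'. (lev i + 1) div 2 = m} = A (2 * d)"
          using d by (auto simp: O'_def A_def elim!: oddE)
        moreover have "card (A (2 * d - 1) \<union> A (2 * d)) \<le> card {i\<in>{..<k}. (lev i + 1) div 2 = m}"
          using 3 d by (intro card_mono) (auto simp: A_def)
        ultimately show ?thesis
          using card_A2[of "2 * d - 1" "2 * d"] d lev_last unfolding A_def by simp
      qed
    qed (auto simp: O'_def)
  qed
qed

section \<open>The bound and its consequence for homeomorphisms\<close>

theorem theorem5p2:
  fixes r :: real
  assumes "1 \<le> r"
  shows "(\<forall>d::nat. d \<ge> 1 \<longrightarrow> (\<forall>k::nat. k \<ge> nat \<lceil>19 powr r\<rceil> ^ (2 * d - 1) + 1 \<longrightarrow>
           (\<forall>F. F ` sphere_inf k \<subseteq> sphere_lp k r \<longrightarrow> step_preserving k F \<longrightarrow> cont_inf_lp k r F \<longrightarrow>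
                F (const_vec k 1) \<noteq> F (const_vec k (-1)) \<longrightarrow>
                modulus k r F (1 / real d) \<ge> 1 / 2)))
       \<and> \<not> (\<exists>F :: nat \<Rightarrow> (nat \<Rightarrow> real) \<Rightarrow> (nat \<Rightarrow> real).
              (\<forall>k\<ge>1. homeo_inf_lp k r (F k) \<and> step_preserving k (F k)) \<and>
              (\<forall>\<epsilon>>0. \<exists>\<delta>>0. \<forall>k\<ge>1. modulus k r (F k) \<delta> < \<epsilon>))"
proof (intro conjI notI)
  show "\<forall>d::nat. d \<ge> 1 \<longrightarrow> (\<forall>k::nat. k \<ge> nat \<lceil>19 powr r\<rceil> ^ (2 * d - 1) + 1 \<longrightarrow>
           (\<forall>F. F ` sphere_inf k \<subseteq> sphere_lp k r \<longrightarrow> step_preserving k F \<longrightarrow> cont_inf_lp k r F \<longrightarrow>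
                F (const_vec k 1) \<noteq> F (const_vec k (-1)) \<longrightarrow>
                modulus k r F (1 / real d) \<ge> 1 / 2))"
    using step_map_modulus_ge_half[OF assms] by blast
next
  assume "\<exists>F :: nat \<Rightarrow> (nat \<Rightarrow> real) \<Rightarrow> (nat \<Rightarrow> real).
              (\<forall>k\<ge>1. homeo_inf_lp k r (F k) \<and> step_preserving k (F k)) \<and>
              (\<forall>\<epsilon>>0. \<exists>\<delta>>0. \<forall>k\<ge>1. modulus k r (F k) \<delta> < \<epsilon>)"
  then obtain F :: "nat \<Rightarrow> (nat \<Rightarrow> real) \<Rightarrow> (nat \<Rightarrow> real)"
    where F: "\<And>k. 1 \<le> k \<Longrightarrow> homeo_inf_lp k r (F k) \<and> step_preserving k (F k)"
      and equi: "\<And>\<epsilon>. 0 < \<epsilon> \<Longrightarrow> \<exists>\<delta>>0. \<forall>k\<ge>1. modulus k r (F k) \<delta> < \<epsilon>"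
    by blast
  obtain \<delta> :: real where \<delta>: "0 < \<delta>" "\<And>k. 1 \<le> k \<Longrightarrow> modulus k r (F k) \<delta> < 1 / 2"
    using equi[of "1 / 2"] by auto
  obtain m where m: "1 / real (Suc m) < \<delta>"
    using reals_Archimedean[OF \<delta>(1)] by (auto simp: inverse_eq_divide)
  \<comment> \<open>Since 1/d is below \<delta>, monotonicity of the modulus turns the bound at 1/d
    into a contradiction in the single dimension \<open>k\<close>.\<close>
  define d where "d = Suc m"
  define k where "k = nat \<lceil>19 powr r\<rceil> ^ (2 * d - 1) + 1"
  have k: "1 \<le> k" by (simp add: k_def)
  have bij: "bij_betw (F k) (sphere_inf k) (sphere_lp k r)" and cont: "cont_inf_lp k r (F k)"
    using F[OF k] by (auto simp: homeo_inf_lp_def)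
  have im: "F k ` sphere_inf k \<subseteq> sphere_lp k r" using bij by (simp add: bij_betw_def)
  have "const_vec k 1 0 \<noteq> const_vec k (-1) 0" using k by (simp add: const_vec_def)
  then have "const_vec k 1 \<noteq> const_vec k (-1)" by metis
  then have "F k (const_vec k 1) \<noteq> F k (const_vec k (-1))"
    using bij_betw_imp_inj_on[OF bij] k by (auto simp: inj_on_def const_vec_in_sphere_inf)
  then have "1 / 2 \<le> modulus k r (F k) (1 / real d)"
    using F[OF k] im cont
    by (intro step_map_modulus_ge_half[OF assms]) (auto simp: d_def k_def)
  also have "\<dots> \<le> modulus k r (F k) \<delta>"
    using m by (intro modulus_mono assms k im) (simp_all add: d_def)
  finally show False using \<delta>(2)[OF k] by simp
qed

end
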